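(* Let $\Omega\subseteq\mathbb{R}^3$ be an open, bounded, simply connected polyhedral region. Then there exists a tetrahedral mesh of $\Omega$ whose associated graph is bipartite.
   Context: A tetrahedral mesh $\mathcal{T}$ of a bounded open polyhedral domain $\mathcal{O}\subseteq\mathbb{R}^3$ (as usual, a domain equal to the interior of its closure, so no slits) is a finite conforming family of closed non-degenerate tetrahedra: their union is the closure of $\mathcal{O}$, and any two distinct tetrahedra meet in the empty set, a common vertex, a common edge, or a common face. The associated graph $\mathcal{G}_{\mathcal{T}}$ has the tetrahedra of $\mathcal{T}$ as vertices, with an arc between distinct $K,L\in\mathcal{T}$ if $|\partial K\cap\partial L|_2>0$ (area), i.e. if they share a common face. Polyhedral domains admit tetrahedral meshes. *)

theory Defs
  imports "HOL-Analysis.Analysis" "Graph_Theory.Pair_Digraph"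
begin

definition polyhedral_domain :: "(real ^ 3) set \<Rightarrow> bool" where
  "polyhedral_domain \<Omega> \<longleftrightarrow>
     open \<Omega> \<and> connected \<Omega> \<and> bounded \<Omega> \<and> interior (closure \<Omega>) = \<Omega> \<and>
     (\<exists>\<P>. finite \<P> \<and> (\<forall>P\<in>\<P>. polytope P) \<and> closure \<Omega> = \<Union>\<P>)"

(* The library's \<open>triangulation\<close> is a finite family of simplices any two of which
   intersect in a common (possibly empty) face. For distinct tetrahedra this face is
   empty, a vertex, an edge or a facet. *)
definition tetrahedral_mesh :: "(real ^ 3) set \<Rightarrow> (real ^ 3) set set \<Rightarrow> bool" where
  "tetrahedral_mesh \<Omega> \<T> \<longleftrightarrow>
     triangulation \<T> \<and> (\<forall>K\<in>\<T>. 3 simplex K) \<and> \<Union>\<T> = closure \<Omega>"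

(* Area is two-dimensional Hausdorff (outer) measure. The factor pi / 4 makes it agree
   with Lebesgue measure on planes. Boundedness of the covering sets has to be required
   since \<open>diameter\<close> is unspecified on unbounded sets. *)
definition hausdorff2_content :: "real \<Rightarrow> 'a::metric_space set \<Rightarrow> ennreal" where
  "hausdorff2_content \<delta> A =
     (INF U \<in> {U :: nat \<Rightarrow> 'a set. A \<subseteq> (\<Union>i. U i) \<and> (\<forall>i. bounded (U i) \<and> diameter (U i) \<le> \<delta>)}.
        \<Sum>i. ennreal (pi / 4 * (diameter (U i))\<^sup>2))"

definition area :: "'a::metric_space set \<Rightarrow> ennreal" where
  "area A = (SUP \<delta> \<in> {0<..}. hausdorff2_content \<delta> A)"

definition mesh_graph :: "(real ^ 3) set set \<Rightarrow> (real ^ 3) set pair_pre_digraph" where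
  "mesh_graph \<T> =
     \<lparr> pverts = \<T>,
       parcs = {(K, L). K \<in> \<T> \<and> L \<in> \<T> \<and> K \<noteq> L \<and> area (frontier K \<inter> frontier L) > 0} \<rparr>"

lemma pair_graph_mesh_graph:
  assumes "tetrahedral_mesh \<Omega> \<T>"
  shows "pair_graph (mesh_graph \<T>)"
proof -
  have fin: "finite \<T>"
    using assms by (simp add: tetrahedral_mesh_def triangulation_def)
  have "parcs (mesh_graph \<T>) \<subseteq> \<T> \<times> \<T>"
    by (auto simp: mesh_graph_def)
  with fin have "finite (parcs (mesh_graph \<T>))"
    by (meson finite_SigmaI finite_subset)
  with fin show ?thesis
    by unfold_locales
      (auto simp: mesh_graph_def symmetric_def Int_commute intro!: symI)
qed

definition bipartite :: "'a pair_pre_digraph \<Rightarrow> bool" where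
  "bipartite G \<longleftrightarrow>
     (\<exists>U V. pverts G = U \<union> V \<and> U \<inter> V = {} \<and> parcs G \<subseteq> U \<times> V \<union> V \<times> U)"

end

theory Submission
  imports Defs
begin

text \<open>Cutting a large box along all hyperplanes that carry facets of the given polytopes yields a
  complex of polytopal cells covering the closure of the domain. Its barycentric subdivision (with
  an arbitrary relative interior point of each cell in place of the barycentre) consists of the
  simplices spanned by the centres of the cells of a full flag. The centres are ordered by the
  dimension of their cells, which orients each tetrahedron. Two tetrahedra with a common facet
  differ in one vertex only, whose position in the order is the same for both, and which lies on
  opposite sides of the facet. Hence their orientations are opposite, and the sign of the
  orientation is a proper 2-colouring.\<close>

section \<open>Area\<close>

lemma area_mono: "A \<subseteq> B \<Longrightarrow> area A \<le> area B"
  unfolding area_def hausdorff2_content_def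
  by (intro SUP_mono' INF_superset_mono order_refl) auto

text \<open>Cutting the segment into \<open>n\<close> equal pieces gives covers of total weight
  \<open>pi / 4 * l\<^sup>2 / n\<close>, which tends to 0.\<close>

lemma area_closed_segment:
  fixes a b :: "'a::euclidean_space"
  shows "area (closed_segment a b) = 0"
proof -
  have *: "hausdorff2_content \<delta> (closed_segment a b) \<le> ennreal e" if "\<delta> > 0" "e > 0" for \<delta> e :: real
  proof -
    define l where "l = dist a b"
    \<comment> \<open>The first bound makes the piece length \<open>l / n\<close> at most
      \<open>\<delta>\<close>, the second makes the total weight of the \<open>n\<close> pieces at
      most \<open>e\<close>.\<close>
    obtain n :: nat where n: "n > l / \<delta>" "n > pi / 4 * l\<^sup>2 / e"
      using reals_Archimedean2 [of "max (l / \<delta>) (pi / 4 * l\<^sup>2 / e)"] by auto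
    have "n > 0"
      using n(1) \<open>\<delta> > 0\<close> by (metis zero_le_dist divide_nonneg_pos l_def not_less of_nat_0 gr0I)
    define pt where "pt t = a + t *\<^sub>R (b - a)" for t :: real
    \<comment> \<open>Covers are sequences; the pieces from index \<open>n\<close> on are empty,
      have diameter 0 and add nothing to the series.\<close>
    define U where "U i = (if i < n then pt ` {real i / n..(real i + 1) / n} else {})" for i
    have distpt: "dist (pt s) (pt t) = \<bar>s - t\<bar> * l" for s t
    proof -
      have "pt s - pt t = (s - t) *\<^sub>R (b - a)"
        by (simp add: pt_def algebra_simps)
      then show ?thesis
        by (simp add: dist_norm l_def norm_minus_commute)
    qed
    have diam: "diameter (U i) \<le> l / n" for i
    proof (cases "i < n")
      case True
      have "dist (pt s) (pt t) \<le> l / n"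
        if "s \<in> {real i / n..(real i + 1) / n}" "t \<in> {real i / n..(real i + 1) / n}" for s t
      proof -
        have "\<bar>s - t\<bar> \<le> 1 / n"
          using that by (auto simp: abs_le_iff add_divide_distrib)
        then have "\<bar>s - t\<bar> * l \<le> 1 / n * l"
          by (intro mult_right_mono) (auto simp: l_def)
        then show ?thesis
          by (simp add: distpt)
      qed
      then show ?thesis
        using True \<open>n > 0\<close> by (intro diameter_le) (auto simp: U_def dist_norm[symmetric] l_def)
    next
      case False
      then show ?thesis by (simp add: U_def l_def)
    qed
    have bdd: "bounded (U i)" for i
    proof -
      have "compact (pt ` {real i / n..(real i + 1) / n})"
        unfolding pt_def by (intro compact_continuous_image continuous_intros) auto
      then show ?thesis
        by (simp add: U_def compact_imp_bounded)
    qed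
    have "l / n \<le> \<delta>"
      using n(1) \<open>n > 0\<close> \<open>\<delta> > 0\<close> by (simp add: field_simps)
    then have small: "diameter (U i) \<le> \<delta>" for i
      using diam[of i] by linarith
    have cover: "closed_segment a b \<subseteq> (\<Union>i. U i)"
    proof
      fix x assume "x \<in> closed_segment a b"
      then obtain t where t: "0 \<le> t" "t \<le> 1" "x = pt t"
        by (auto simp: closed_segment_def pt_def algebra_simps)
      show "x \<in> (\<Union>i. U i)"
      \<comment> \<open>For \<open>t = 1\<close> the index \<open>\<lfloor>t * n\<rfloor>\<close>
        would be \<open>n\<close>, whose piece is empty; the endpoint belongs to piece
        \<open>n - 1\<close>.\<close>
      proof (cases "t = 1")
        case True
        have "x \<in> U (n - 1)"
          using \<open>n > 0\<close> t True by (auto simp: U_def of_nat_diff intro!: image_eqI[of _ _ 1] divide_le_eq_1[THEN iffD2])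
        then show ?thesis by blast
      next
        case False
        define i where "i = nat \<lfloor>t * n\<rfloor>"
        have ri: "real i = of_int \<lfloor>t * n\<rfloor>"
          using t by (simp add: i_def)
        have i: "real i \<le> t * n" "t * n < real i + 1"
          unfolding ri by linarith+
        have "t * n < n"
          using t False \<open>n > 0\<close> by simp
        then have "i < n"
          using i by linarith
        then have "x \<in> U i"
          using i t \<open>n > 0\<close> by (auto simp: U_def field_simps)
        then show ?thesis by blast
      qed
    qed
    have "hausdorff2_content \<delta> (closed_segment a b) \<le> (\<Sum>i. ennreal (pi / 4 * (diameter (U i))\<^sup>2))"
      unfolding hausdorff2_content_def using cover bdd small by (intro INF_lower) auto
    also have "\<dots> = (\<Sum>i<n. ennreal (pi / 4 * (diameter (U i))\<^sup>2))"
      by (intro suminf_finite) (auto simp: U_def)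
    also have "\<dots> \<le> (\<Sum>i<n. ennreal (pi / 4 * (l / n)\<^sup>2))"
      using diam by (intro sum_mono ennreal_leI mult_left_mono power_mono) (auto simp: diameter_ge_0 bdd)
    also have "\<dots> = ennreal (n * (pi / 4 * (l / n)\<^sup>2))"
      by (subst sum_ennreal) auto
    also have "\<dots> \<le> ennreal e"
      using n(2) \<open>n > 0\<close> \<open>e > 0\<close> by (intro ennreal_leI) (simp add: field_simps power2_eq_square)
    finally show ?thesis .
  qed
  have "hausdorff2_content \<delta> (closed_segment a b) = 0" if "\<delta> > 0" for \<delta>
  proof -
    have "hausdorff2_content \<delta> (closed_segment a b) \<le> 0 + ennreal e" if "e > 0" for e
      using *[OF \<open>\<delta> > 0\<close> that] by simp
    then have "hausdorff2_content \<delta> (closed_segment a b) \<le> 0"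
      by (rule ennreal_le_epsilon)
    then show ?thesis
      by simp
  qed
  then show ?thesis
    unfolding area_def by (auto simp: SUP_eq_iff)
qed

text \<open>Such a hull lies in a possibly degenerate segment. This will show that simplices with at
  most two common vertices share no area.\<close>

lemma area_convex_hull_le_2:
  fixes S :: "'a::euclidean_space set"
  assumes "finite S" "card S \<le> 2"
  shows "area (convex hull S) = 0"
proof -
  have "card S = 0 \<or> card S = 1 \<or> card S = 2"
    using assms(2) by linarith
  then have "S = {} \<or> (\<exists>a b. S = {a, b})"
    using assms(1) by (metis card_0_eq card_1_singletonE card_2_iff insert_absorb2)
  then have "\<exists>a b. convex hull S \<subseteq> closed_segment a b"
    by (metis convex_hull_empty empty_subsetI order_refl segment_convex_hull)
  then obtain a b where "convex hull S \<subseteq> closed_segment a b" by blast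
  from area_mono[OF this] show ?thesis
    by (simp add: area_closed_segment)
qed

section \<open>Oriented tetrahedra\<close>

text \<open>Six times the signed volume of the tetrahedron with vertices \<open>p 0\<close>, ...,
  \<open>p 3\<close>. The indices are integers because they will be values of
  \<open>aff_dim\<close>.\<close>

definition orientation :: "(int \<Rightarrow> real ^ 3) \<Rightarrow> real" where
  "orientation p = cross3 (p 1 - p 0) (p 2 - p 0) \<bullet> (p 3 - p 0)"

lemma index_cases: "i \<in> {0..3} \<Longrightarrow> i = 0 \<or> i = 1 \<or> i = 2 \<or> i = (3::int)"
  by (auto; linarith)

lemma orientation_cong: "(\<And>i. i \<in> {0..3} \<Longrightarrow> p i = q i) \<Longrightarrow> orientation p = orientation q"
  by (simp add: orientation_def)

text \<open>A repeated point makes one of the three edge vectors zero or two of them equal.\<close>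

lemma orientation_upd_eq_0:
  assumes "i \<in> {0..3}" "j \<in> {0..3}" "i \<noteq> j"
  shows "orientation (p(i := p j)) = 0"
  using index_cases[OF assms(1)] index_cases[OF assms(2)] assms(3)
  by (auto simp: orientation_def dot_cross_self)

text \<open>The triple product is antisymmetric in the four points, so every slot can be moved to the
  last one, in which it is visibly affine.\<close>

lemma orientation_upd_affine:
  assumes "i \<in> {0..3}" and u: "sum u S = 1"
  shows "orientation (p(i := \<Sum>j\<in>S. u j *\<^sub>R f j)) = (\<Sum>j\<in>S. u j * orientation (p(i := f j)))"
proof -
  define T :: "real ^ 3 \<Rightarrow> real ^ 3 \<Rightarrow> real ^ 3 \<Rightarrow> real ^ 3 \<Rightarrow> real"
    where "T a b c d = cross3 (b - a) (c - a) \<bullet> (d - a)" for a b c d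
  have last: "T a b c (\<Sum>j\<in>S. u j *\<^sub>R f j) = (\<Sum>j\<in>S. u j * T a b c (f j))" for a b c
  proof -
    have "(\<Sum>j\<in>S. u j *\<^sub>R f j) - a = (\<Sum>j\<in>S. u j *\<^sub>R f j) - sum u S *\<^sub>R a"
      using u by simp
    also have "\<dots> = (\<Sum>j\<in>S. u j *\<^sub>R (f j - a))"
      by (simp add: scaleR_sum_left scaleR_diff_right sum_subtractf)
    finally show ?thesis
      by (simp add: T_def inner_sum_right)
  qed
  have swap: "T a b c d = - T a b d c" "T a b c d = - T a d c b" "T a b c d = - T d b c a" for a b c d
    by (simp_all add: T_def cross3_simps)
  have eq: "orientation q = T (q 0) (q 1) (q 2) (q 3)" for q
    by (simp add: orientation_def T_def)
  from index_cases[OF assms(1)] show ?thesis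
  proof (elim disjE)
    assume "i = 0"
    then show ?thesis
      by (simp add: eq last sum_negf swap(3)[of "_ :: real ^ 3" "p 1" "p 2" "p 3"])
  next
    assume "i = 1"
    then show ?thesis
      by (simp add: eq last sum_negf swap(2)[of "p 0" _ "p 2" "p 3"])
  next
    assume "i = 2"
    then show ?thesis
      by (simp add: eq last sum_negf swap(1)[of "p 0" "p 1" _ "p 3"])
  next
    assume "i = 3"
    then show ?thesis
      by (simp add: eq last)
  qed
qed

text \<open>Cramer's rule for barycentric coordinates: by affinity only the term
  \<open>j = i\<close> survives, since every other one has a repeated point.\<close>

lemma orientation_upd_affine_combination:
  assumes i: "i \<in> {0..3}" and u: "sum u {0..3} = 1"
  shows "orientation (p(i := \<Sum>j\<in>{0..3}. u j *\<^sub>R p j)) = u i * orientation p"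
proof -
  have "orientation (p(i := \<Sum>j\<in>{0..3}. u j *\<^sub>R p j)) = (\<Sum>j\<in>{0..3}. u j * orientation (p(i := p j)))"
    using assms by (rule orientation_upd_affine)
  also have "\<dots> = (\<Sum>j\<in>{0..3}. if j = i then u i * orientation p else 0)"
    using i by (intro sum.cong) (auto simp: orientation_upd_eq_0)
  finally show ?thesis
    using i by simp
qed

lemma affine_coordinates_simplex:
  fixes p :: "int \<Rightarrow> real ^ 3"
  assumes inj: "inj_on p {0..3}" and ind: "\<not> affine_dependent (p ` {0..3})"
  obtains u where "sum u {0..3} = 1" "x = (\<Sum>j\<in>{0..3}. u j *\<^sub>R p j)"
proof -
  have "card (p ` {0..3}) = 4"
    using inj by (simp add: card_image)
  then have "affine hull (p ` {0..3}) = UNIV"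
    using ind by (intro affine_independent_span_eq) auto
  then obtain v where "sum v (p ` {0..3}) = 1" "(\<Sum>y\<in>p ` {0..3}. v y *\<^sub>R y) = x"
    by (auto simp: affine_hull_finite set_eq_iff)
  with inj that[of "v \<circ> p"] show ?thesis
    by (simp add: sum.reindex o_def)
qed

text \<open>If the orientation vanished, it would still vanish after moving the last vertex
  anywhere, since every point is an affine combination of the four. This forces the first three to
  be collinear.\<close>

lemma orientation_nonzero:
  assumes inj: "inj_on p {0..3}" and ind: "\<not> affine_dependent (p ` {0..3})"
  shows "orientation p \<noteq> 0"
proof
  assume 0: "orientation p = 0"
  have "orientation (p(3 := x)) = 0" for x
  proof -
    obtain u where "sum u {0..3} = 1" "x = (\<Sum>j\<in>{0..3}. u j *\<^sub>R p j)"
      using affine_coordinates_simplex[OF assms] .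
    then show ?thesis
      using orientation_upd_affine_combination[of 3 u p] 0 by simp
  qed
  \<comment> \<open>For this choice of the last vertex the orientation is the squared norm of the
    cross product.\<close>
  from this[of "p 0 + cross3 (p 1 - p 0) (p 2 - p 0)"] have "cross3 (p 1 - p 0) (p 2 - p 0) = 0"
    by (simp add: orientation_def)
  then have "collinear {0, p 1 - p 0, p 2 - p 0}"
    by (simp add: cross_eq_0)
  then have "collinear {p 1, p 0, p 2}"
    by (simp add: collinear_3[of "p 1" "p 0" "p 2"])
  moreover have "p 1 \<noteq> p 0" "p 1 \<noteq> p 2" "p 0 \<noteq> p 2"
    using inj by (simp_all add: inj_on_eq_iff)
  ultimately have "affine_dependent {p 1, p 0, p 2}"
    by (simp add: collinear_3_eq_affine_dependent)
  then have "affine_dependent (p ` {0..3})"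
    by (rule affine_dependent_subset) auto
  with ind show False by blast
qed

text \<open>Two simplices on the same side of a common facet overlap near its barycentre.\<close>

lemma same_orientation_overlap:
  assumes inj: "inj_on p {0..3}" and ind: "\<not> affine_dependent (p ` {0..3})"
    and i: "i \<in> {0..3}" and pos: "orientation p * orientation (p(i := x)) > 0"
  obtains y where "y \<in> convex hull (p ` {0..3})" "y \<in> convex hull (p(i := x) ` {0..3})"
    "y \<notin> convex hull (p ` ({0..3} - {i}))"
proof -
  obtain u where u: "sum u {0..3} = 1" "x = (\<Sum>j\<in>{0..3}. u j *\<^sub>R p j)"
    using affine_coordinates_simplex[OF inj ind] .
  have "orientation (p(i := x)) = u i * orientation p"
    using orientation_upd_affine_combination[OF i u(1), of p] u(2) by simp
  \<comment> \<open>Positivity of \<open>u i\<close> says that \<open>x\<close> lies on the same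
    side of the facet opposite \<open>p i\<close> as \<open>p i\<close> itself.\<close>
  with pos have "u i > 0"
    by (auto simp: zero_less_mult_iff mult_less_0_iff)
  define J where "J = {0..3} - {i}"
  have J: "finite J" "{0..3} = insert i J" "i \<notin> J" "card J = 3"
    using i by (auto simp: J_def)
  \<comment> \<open>Small enough that \<open>e * (1 + 3 * \<bar>u j\<bar>) \<le> 1\<close> for all
    \<open>j\<close>, which ensures \<open>c j \<ge> 0\<close>.\<close>
  define e where "e = 1 / (1 + 3 * (\<Sum>j\<in>{0..3}. \<bar>u j\<bar>))"
  have s: "(\<Sum>j\<in>{0..3}. \<bar>u j\<bar>) \<ge> 0"
    by (simp add: sum_nonneg)
  then have e: "0 < e" "e \<le> 1"
    by (auto simp: e_def divide_le_eq_1 add_pos_nonneg)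
  \<comment> \<open>The point \<open>y\<close> is the barycentre of the common facet moved by the
    fraction \<open>e\<close> towards \<open>x\<close>; \<open>c\<close> and \<open>d\<close> are
    its coordinates with respect to \<open>p\<close> and \<open>p(i := x)\<close>.\<close>
  define c where "c j = (if j = i then e * u i else (1 - e) / 3 + e * u j)" for j
  define d where "d j = (if j = i then e else (1 - e) / 3)" for j
  define y where "y = (\<Sum>j\<in>{0..3}. d j *\<^sub>R (p(i := x)) j)"
  have c_nonneg: "0 \<le> c j" if "j \<in> {0..3}" for j
  proof (cases "j = i")
    case False
    have "\<bar>u j\<bar> \<le> (\<Sum>j\<in>{0..3}. \<bar>u j\<bar>)"
      using that by (intro member_le_sum) auto
    then have "e * (1 + 3 * \<bar>u j\<bar>) \<le> e * (1 + 3 * (\<Sum>j\<in>{0..3}. \<bar>u j\<bar>))"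
      using e by (intro mult_left_mono) auto
    also have "\<dots> = 1"
      using s by (simp add: e_def add_nonneg_eq_0_iff)
    finally have "e + 3 * (e * \<bar>u j\<bar>) \<le> 1"
      by (simp add: algebra_simps)
    moreover have "e * (- u j) \<le> e * \<bar>u j\<bar>"
      using e(1) by (intro mult_left_mono) auto
    ultimately have "0 \<le> (1 - e) + 3 * (e * u j)"
      by simp
    then have "0 \<le> (1 - e) / 3 + e * u j"
      by (simp add: field_simps)
    then show ?thesis
      using False by (simp add: c_def)
  qed (use e \<open>u i > 0\<close> in \<open>simp add: c_def\<close>)
  have sumd: "sum d {0..3} = 1"
  proof -
    have "J \<inter> - {i} = J"
      using J(3) by blast
    then show ?thesis
      unfolding J(2) using J(1,3,4) by (simp add: d_def sum.If_cases field_simps)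
  qed
  have y_eq: "y = (\<Sum>j\<in>{0..3}. c j *\<^sub>R p j)"
  proof -
    have "y = e *\<^sub>R x + (\<Sum>j\<in>J. ((1 - e) / 3) *\<^sub>R p j)"
      unfolding y_def J(2) using J(1,3) by (subst sum.insert) (auto simp: d_def intro!: sum.cong)
    also have "x = u i *\<^sub>R p i + (\<Sum>j\<in>J. u j *\<^sub>R p j)"
      unfolding u(2) J(2) using J(1,3) by simp
    also have "e *\<^sub>R (u i *\<^sub>R p i + (\<Sum>j\<in>J. u j *\<^sub>R p j)) + (\<Sum>j\<in>J. ((1 - e) / 3) *\<^sub>R p j) =
        (e * u i) *\<^sub>R p i + (\<Sum>j\<in>J. ((1 - e) / 3 + e * u j) *\<^sub>R p j)"
      by (simp add: scaleR_add_right scaleR_add_left sum.distrib scaleR_sum_right)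
    also have "\<dots> = (\<Sum>j\<in>{0..3}. c j *\<^sub>R p j)"
      unfolding J(2) using J(1,3) by (subst sum.insert) (auto simp: c_def intro!: sum.cong)
    finally show ?thesis .
  qed
  have "sum c {0..3} = e * u i + (\<Sum>j\<in>J. (1 - e) / 3 + e * u j)"
    unfolding J(2) using J(1,3) by (subst sum.insert) (auto simp: c_def intro!: sum.cong)
  also have "\<dots> = (1 - e) + e * sum u {0..3}"
    unfolding J(2) using J(1,3,4) by (simp add: sum.distrib sum_distrib_left distrib_left)
  finally have sumc: "sum c {0..3} = 1"
    using u(1) by simp
  show ?thesis
  proof
    show "y \<in> convex hull (p ` {0..3})"
      unfolding y_eq by (intro convex_sum sumc c_nonneg hull_inc) auto
    show "y \<in> convex hull (p(i := x) ` {0..3})"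
      unfolding y_def using e by (intro convex_sum sumd hull_inc imageI) (auto simp: d_def)
    show "y \<notin> convex hull (p ` ({0..3} - {i}))"
    proof
      assume "y \<in> convex hull (p ` ({0..3} - {i}))"
      then obtain v where v: "sum v (p ` J) = 1" "(\<Sum>z\<in>p ` J. v z *\<^sub>R z) = y"
        by (auto simp: convex_hull_finite J_def)
      have injJ: "inj_on p J"
        using inj by (rule inj_on_subset) (auto simp: J_def)
      \<comment> \<open>Putting a point of the facet into slot \<open>i\<close> gives orientation 0,
        whereas \<open>y\<close> gives \<open>c i * orientation p\<close> with
        \<open>c i = e * u i\<close> positive.\<close>
      have "orientation (p(i := y)) = (\<Sum>j\<in>J. v (p j) * orientation (p(i := p j)))"
        using orientation_upd_affine[OF i, of "v \<circ> p" J p p] v injJ by (simp add: sum.reindex)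
      also have "\<dots> = 0"
        using i by (intro sum.neutral) (auto simp: J_def intro!: orientation_upd_eq_0)
      finally have "c i * orientation p = 0"
        using orientation_upd_affine_combination[OF i sumc, of p] y_eq by simp
      then show False
        using e \<open>u i > 0\<close> orientation_nonzero[OF inj ind] by (simp add: c_def)
    qed
  qed
qed

section \<open>Barycentric subdivision\<close>

text \<open>A polytopal complex without the empty cell, so that every cell has a centre. Two cells
  may be disjoint, hence \<open>cell_Int_face\<close> asks for a face and not for a cell.\<close>

locale centred_cell_complex =
  fixes \<M> :: "'a::euclidean_space set set" and b :: "'a set \<Rightarrow> 'a"
  assumes finite_cells: "finite \<M>"
    and cell_polytope: "A \<in> \<M> \<Longrightarrow> polytope A"
    and cell_nonempty: "A \<in> \<M> \<Longrightarrow> A \<noteq> {}"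
    and face_cell: "A \<in> \<M> \<Longrightarrow> F face_of A \<Longrightarrow> F \<noteq> {} \<Longrightarrow> F \<in> \<M>"
    and cell_Int_face: "A \<in> \<M> \<Longrightarrow> B \<in> \<M> \<Longrightarrow> A \<inter> B face_of A"
    and centre: "A \<in> \<M> \<Longrightarrow> b A \<in> rel_interior A"
begin

section \<open>Cells and their relative interiors\<close>

lemma cell_convex: "A \<in> \<M> \<Longrightarrow> convex A"
  using cell_polytope polytope_imp_convex by blast

lemma cell_aff_dim_nonneg: "A \<in> \<M> \<Longrightarrow> 0 \<le> aff_dim A"
  using cell_nonempty[of A] aff_dim_geq[of A] aff_dim_negative_iff[of A] by linarith

lemma centre_in: "A \<in> \<M> \<Longrightarrow> b A \<in> A"
  using centre rel_interior_subset by blast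

lemma subset_face: "A \<in> \<M> \<Longrightarrow> B \<in> \<M> \<Longrightarrow> A \<subseteq> B \<Longrightarrow> A face_of B"
  using cell_Int_face[of B A] by (simp add: Int_absorb1)

lemma psubset_aff_dim: "A \<in> \<M> \<Longrightarrow> B \<in> \<M> \<Longrightarrow> A \<subset> B \<Longrightarrow> aff_dim A < aff_dim B"
  using face_of_aff_dim_lt[OF cell_convex subset_face] by blast

text \<open>The face \<open>C \<inter> D\<close> of \<open>C\<close> meets the relative interior of
  \<open>C\<close>, so it is all of \<open>C\<close>; by symmetry the two cells coincide.\<close>

lemma rel_interior_cells_eq:
  assumes "A \<in> \<M>" "B \<in> \<M>" "x \<in> rel_interior A" "x \<in> rel_interior B"
  shows "A = B"
proof -
  have sub: "C \<subseteq> D"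
    if "C \<in> \<M>" "D \<in> \<M>" "x \<in> rel_interior C" "x \<in> rel_interior D" for C D
  proof -
    have "x \<in> D \<inter> C"
      using that rel_interior_subset by blast
    then show ?thesis
      using face_of_disjoint_rel_interior[OF cell_Int_face[OF that(1,2)]] that(3) by blast
  qed
  show ?thesis
    using sub assms by blast
qed

lemma inj_on_centre: "inj_on b \<M>"
  by (rule inj_onI) (metis centre rel_interior_cells_eq)

section \<open>Flags and the simplices spanned by their centres\<close>

abbreviation flag :: "'a set set \<Rightarrow> bool" where
  "flag C \<equiv> subset.chain \<M> C"

lemma flag_finite: "flag C \<Longrightarrow> finite C"
  using finite_cells finite_subset by (auto simp: subset_chain_def)

lemma flag_subset: "flag C \<Longrightarrow> D \<subseteq> C \<Longrightarrow> flag D"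
  unfolding subset_chain_def by blast

lemma flag_inj_on_centre: "flag C \<Longrightarrow> inj_on b C"
  using inj_on_centre inj_on_subset by (auto simp: subset_chain_def)

text \<open>Distinct comparable cells have different dimensions. This later lets the dimension
  number the vertices of a simplex.\<close>

lemma flag_inj_on_aff_dim:
  assumes "flag C"
  shows "inj_on aff_dim C"
proof (rule inj_onI)
  fix A B assume "A \<in> C" "B \<in> C" "aff_dim A = aff_dim B"
  then show "A = B"
    using psubset_aff_dim[of A B] psubset_aff_dim[of B A] assms
    unfolding subset_chain_def by (metis psubsetI less_irrefl subsetD)
qed

lemma flag_top:
  assumes "flag C" "C \<noteq> {}"
  obtains T where "T \<in> C" "\<And>A. A \<in> C \<Longrightarrow> A \<subseteq> T"
proof -
  obtain T where T: "T \<in> C" "\<And>A. A \<in> C \<Longrightarrow> T \<subseteq> A \<Longrightarrow> T = A"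
    using finite_has_maximal[OF flag_finite[OF assms(1)] assms(2)] by blast
  have "A \<subseteq> T" if "A \<in> C" for A
  proof -
    have "A \<subseteq> T \<or> T \<subseteq> A"
      using assms(1) that T(1) by (simp add: subset_chain_def)
    then show ?thesis
      using T(2)[OF that] by blast
  qed
  with T(1) show ?thesis
    by (rule that)
qed

text \<open>The second largest cell of the flag is a proper face of \<open>T\<close> and contains
  all lower cells, hence their centres.\<close>

lemma centres_below_top:
  assumes C: "flag C" "T \<in> C" "\<And>A. A \<in> C \<Longrightarrow> A \<subseteq> T" and ne: "C - {T} \<noteq> {}"
  obtains F where "F face_of T" "F \<noteq> T" "b ` (C - {T}) \<subseteq> F"
proof -
  obtain F where F: "F \<in> C - {T}" "\<And>A. A \<in> C - {T} \<Longrightarrow> A \<subseteq> F"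
    using flag_top[OF flag_subset[OF C(1)] ne] by blast
  have cells: "C \<subseteq> \<M>"
    using C(1) by (simp add: subset_chain_def)
  show ?thesis
  proof
    show "F face_of T"
      using F C cells by (intro subset_face) auto
    show "F \<noteq> T" using F by blast
    show "b ` (C - {T}) \<subseteq> F"
      using F(2) cells centre_in by blast
  qed
qed

lemma convex_hull_below_top:
  assumes "flag C" "T \<in> C" "\<And>A. A \<in> C \<Longrightarrow> A \<subseteq> T" and y: "y \<in> convex hull (b ` (C - {T}))"
  shows "y \<in> T" "y \<notin> rel_interior T"
proof -
  have "C - {T} \<noteq> {}"
    using y by (metis convex_hull_empty empty_iff image_empty)
  then obtain F where F: "F face_of T" "F \<noteq> T" "b ` (C - {T}) \<subseteq> F"
    using centres_below_top[OF assms(1-3)] by blast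
  have "convex hull (b ` (C - {T})) \<subseteq> F"
    using F(3) face_of_imp_convex[OF F(1)] by (rule hull_minimal)
  with y have "y \<in> F" by blast
  then show "y \<in> T" "y \<notin> rel_interior T"
    using face_of_imp_subset[OF F(1)] face_of_disjoint_rel_interior[OF F(1,2)] by blast+
qed

text \<open>Induction by removing the largest cell \<open>T\<close>: the affine hull of a proper
  face misses the relative interior of \<open>T\<close>, so the centre of \<open>T\<close> lies
  outside the affine hull of the other centres.\<close>

lemma flag_affine_independent:
  assumes "flag C"
  shows "\<not> affine_dependent (b ` C)"
  using flag_finite[OF assms] assms
proof (induction C rule: finite_psubset_induct)
  case (psubset C)
  show ?case
  proof (cases "C = {}")
    case False
    then obtain T where T: "T \<in> C" "\<And>A. A \<in> C \<Longrightarrow> A \<subseteq> T"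
      using flag_top psubset.prems by blast
    have eq: "b ` C = insert (b T) (b ` (C - {T}))"
      using T(1) by blast
    have "\<not> affine_dependent (b ` (C - {T}))"
      using T(1) psubset.prems flag_subset[of C "C - {T}"] by (intro psubset.IH) auto
    moreover have "b T \<notin> affine hull (b ` (C - {T}))"
    proof (cases "C - {T} = {}")
      case True
      then show ?thesis by (simp only: image_empty affine_hull_empty) simp
    next
      case ne: False
      obtain F where F: "F face_of T" "F \<noteq> T" "b ` (C - {T}) \<subseteq> F"
        using centres_below_top[OF psubset.prems T ne] by blast
      have "T \<in> \<M>"
        using T(1) psubset.prems by (auto simp: subset_chain_def)
      then have "b T \<notin> affine hull F"
        using affine_hull_face_of_disjoint_rel_interior[OF cell_convex F(1,2)] centre by blast
      then show ?thesis
        using hull_mono[OF F(3)] by blast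
    qed
    ultimately show ?thesis
      unfolding eq by (rule affine_independent_insert)
  qed simp
qed

text \<open>The simplex is a cone with apex \<open>b T\<close> over the hull of the remaining
  centres, and \<open>u = 0\<close> only at the apex.\<close>

lemma convex_hull_remove_top:
  assumes "flag C" "T \<in> C" "\<And>A. A \<in> C \<Longrightarrow> A \<subseteq> T" and x: "x \<in> convex hull (b ` C)"
    and not: "x \<noteq> b T"
  obtains u y where "0 < u" "u \<le> 1" "y \<in> convex hull (b ` (C - {T}))" "x = (1 - u) *\<^sub>R b T + u *\<^sub>R y"
proof -
  have eq: "b ` C = insert (b T) (b ` (C - {T}))"
    using assms(2) by blast
  have "b ` (C - {T}) \<noteq> {}"
  proof
    assume "b ` (C - {T}) = {}"
    then have "b ` C = {b T}"
      by (simp only: eq)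
    with x not show False by simp
  qed
  then obtain u y where uy: "0 \<le> u" "u \<le> 1" "y \<in> convex hull (b ` (C - {T}))"
      "x = (1 - u) *\<^sub>R b T + u *\<^sub>R y"
    using x unfolding eq convex_hull_insert_alt by auto
  moreover have "u \<noteq> 0"
    using uy(4) not by auto
  ultimately show ?thesis
    using that[of u y] by simp
qed

text \<open>The cell containing a point in its relative interior is the largest one that contributes to
  the point, so it belongs to both flags. Projecting from its centre to its relative boundary
  removes it from both.\<close>

lemma convex_hull_flag_Int_aux:
  assumes "flag C" "flag D" "x \<in> convex hull (b ` C)" "x \<in> convex hull (b ` D)"
  shows "x \<in> convex hull (b ` (C \<inter> D))"
  using assms
\<comment> \<open>One flag may lose its largest cell while the other stays unchanged, so the
  induction runs on the sum of the sizes.\<close>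
proof (induction "card C + card D" arbitrary: C D x rule: less_induct)
  case less
  have "C \<noteq> {}" "D \<noteq> {}"
    using less.prems(3,4) by auto
  obtain T where T: "T \<in> C" "\<And>A. A \<in> C \<Longrightarrow> A \<subseteq> T"
    using flag_top[OF less.prems(1) \<open>C \<noteq> {}\<close>] by blast
  obtain S where S: "S \<in> D" "\<And>A. A \<in> D \<Longrightarrow> A \<subseteq> S"
    using flag_top[OF less.prems(2) \<open>D \<noteq> {}\<close>] by blast
  have TM: "T \<in> \<M>" and SM: "S \<in> \<M>"
    using less.prems(1,2) T(1) S(1) by (auto simp: subset_chain_def)
  have fl: "flag (C - {T})" "flag (D - {S})"
    using less.prems(1,2) flag_subset by blast+
  have card: "card (C - {T}) < card C" "card (D - {S}) < card D"
    using T(1) S(1) less.prems(1,2) flag_finite by (blast intro: card_Diff1_less)+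
  \<comment> \<open>If \<open>b R\<close> had positive weight in \<open>x\<close>, then
    \<open>x\<close> would be a point \<open>y \<in> R\<close> shrunk towards \<open>b R\<close>,
    hence in the relative interior of \<open>R\<close>.\<close>
  have lower: "x \<in> convex hull (b ` (E - {R}))"
    if E: "flag E" "R \<in> E" "\<And>A. A \<in> E \<Longrightarrow> A \<subseteq> R" "x \<in> convex hull (b ` E)" and x: "x \<notin> rel_interior R"
    for E R x
  proof -
    have R: "R \<in> \<M>"
      using E(1,2) by (auto simp: subset_chain_def)
    then have "x \<noteq> b R"
      using x centre by blast
    then obtain u y where uy: "0 < u" "u \<le> 1" "y \<in> convex hull (b ` (E - {R}))" "x = (1 - u) *\<^sub>R b R + u *\<^sub>R y"
      using convex_hull_remove_top[OF E] by blast
    have "u = 1"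
    proof (rule ccontr)
      assume "u \<noteq> 1"
      then have "y - (1 - u) *\<^sub>R (y - b R) \<in> rel_interior R"
        using uy(1,2) convex_hull_below_top(1)[OF E(1-3) uy(3)]
        by (intro rel_interior_convex_shrink cell_convex centre R) auto
      with x uy(4) show False
        by (simp add: algebra_simps)
    qed
    with uy show ?thesis by simp
  qed
  show ?case
  proof (cases "x \<in> rel_interior T \<and> x \<in> rel_interior S")
    case False
    then consider "x \<notin> rel_interior T" | "x \<notin> rel_interior S" by blast
    then show ?thesis
    proof cases
      case 1
      then have "x \<in> convex hull (b ` (C - {T}))"
        using lower[OF less.prems(1) T less.prems(3)] by blast
      then have "x \<in> convex hull (b ` ((C - {T}) \<inter> D))"
        using less.hyps[OF _ fl(1) less.prems(2)] less.prems(4) card by simp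
      then show ?thesis
        using hull_mono[of "b ` ((C - {T}) \<inter> D)" "b ` (C \<inter> D)"] by blast
    next
      case 2
      then have "x \<in> convex hull (b ` (D - {S}))"
        using lower[OF less.prems(2) S less.prems(4)] by blast
      then have "x \<in> convex hull (b ` (C \<inter> (D - {S})))"
        using less.hyps[OF _ less.prems(1) fl(2)] less.prems(3) card by simp
      then show ?thesis
        using hull_mono[of "b ` (C \<inter> (D - {S}))" "b ` (C \<inter> D)"] by blast
    qed
  next
    case True
    then have [simp]: "S = T"
      using rel_interior_cells_eq TM SM by blast
    have in_hull: "b T \<in> convex hull (b ` (C \<inter> D))"
      using T(1) S(1) by (intro hull_inc) auto
    show ?thesis
    proof (cases "x = b T")
      case False
      obtain u y where uy: "0 < u" "u \<le> 1" "y \<in> convex hull (b ` (C - {T}))"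
          "x = (1 - u) *\<^sub>R b T + u *\<^sub>R y"
        using convex_hull_remove_top[OF less.prems(1) T less.prems(3) False] .
      obtain v z where vz: "0 < v" "v \<le> 1" "z \<in> convex hull (b ` (D - {T}))"
          "x = (1 - v) *\<^sub>R b T + v *\<^sub>R z"
        using convex_hull_remove_top[OF less.prems(2), of T x] S less.prems(4) False by auto
      have y: "y \<in> T" "y \<notin> rel_interior T"
        using convex_hull_below_top[OF less.prems(1) T uy(3)] by blast+
      have z: "z \<in> T" "z \<notin> rel_interior T"
        using convex_hull_below_top[OF less.prems(2), of T z] S vz(3) by auto
      \<comment> \<open>A ray from \<open>b T\<close> leaves the relative interior only once: with
        \<open>s < t\<close> the point \<open>q\<close> would be \<open>p\<close> shrunk towards
        \<open>b T\<close>, hence in the relative interior. So the projection of \<open>x\<close> is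
        unique.\<close>
      have shrink: False
        if "0 < s" "s < t" "p \<in> T" "q \<notin> rel_interior T"
          "(1 - s) *\<^sub>R b T + s *\<^sub>R p = (1 - t) *\<^sub>R b T + t *\<^sub>R q" for s t :: real and p q
      proof -
        have "t *\<^sub>R q = s *\<^sub>R p + (t - s) *\<^sub>R b T"
          using that(5) by (simp add: algebra_simps)
        then have "(1 / t) *\<^sub>R (t *\<^sub>R q) = (1 / t) *\<^sub>R (s *\<^sub>R p + (t - s) *\<^sub>R b T)"
          by simp
        then have "q = (s / t) *\<^sub>R p + ((t - s) / t) *\<^sub>R b T"
          using that(1,2) by (simp add: scaleR_add_right)
        also have "\<dots> = p - ((t - s) / t) *\<^sub>R (p - b T)"
        proof -
          have "s / t = 1 - (t - s) / t"
            using that(1,2) by (simp add: field_simps)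
          then show ?thesis
            by (simp only: scaleR_diff_left scaleR_diff_right scaleR_one) simp
        qed
        also have "\<dots> \<in> rel_interior T"
          using that(1-3) by (intro rel_interior_convex_shrink cell_convex centre TM) auto
        finally show False
          using that(4) by blast
      qed
      have "u = v"
        using shrink[of u v y z] shrink[of v u z y] uy vz y z by (metis linorder_neqE_linordered_idom)
      moreover from this have "y = z"
        using uy vz by simp
      ultimately have "y \<in> convex hull (b ` ((C - {T}) \<inter> (D - {T})))"
        using less.hyps[OF _ fl] uy(3) vz(3) card by simp
      then have "y \<in> convex hull (b ` (C \<inter> D))"
        using hull_mono[of "b ` ((C - {T}) \<inter> (D - {T}))" "b ` (C \<inter> D)"] by blast
      then show ?thesis
        unfolding uy(4) using uy(1,2) in_hull by (intro convexD convex_convex_hull) auto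
    qed (use in_hull in simp)
  qed
qed

lemma convex_hull_flag_Int:
  assumes "flag C" "flag D"
  shows "convex hull (b ` C) \<inter> convex hull (b ` D) = convex hull (b ` (C \<inter> D))"
proof
  show "convex hull (b ` C) \<inter> convex hull (b ` D) \<subseteq> convex hull (b ` (C \<inter> D))"
    using convex_hull_flag_Int_aux[OF assms] by blast
  show "convex hull (b ` (C \<inter> D)) \<subseteq> convex hull (b ` C) \<inter> convex hull (b ` D)"
    by (intro Int_greatest hull_mono image_mono) auto
qed

section \<open>Covering the cells by simplices of flags\<close>

lemma convex_hull_flag_subset: "flag C \<Longrightarrow> convex hull (b ` C) \<subseteq> \<Union>\<M>"
proof (cases "C = {}")
  case False
  assume "flag C"
  then obtain T where T: "T \<in> C" "\<And>A. A \<in> C \<Longrightarrow> A \<subseteq> T"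
    using flag_top False by blast
  with \<open>flag C\<close> have "C \<subseteq> \<M>" "T \<in> \<M>"
    by (auto simp: subset_chain_def)
  then have "b ` C \<subseteq> T"
    using T(2) centre_in by blast
  then have "convex hull (b ` C) \<subseteq> T"
    using cell_convex \<open>T \<in> \<M>\<close> by (intro hull_minimal)
  then show ?thesis
    using \<open>T \<in> \<M>\<close> by blast
qed simp

text \<open>Project \<open>x\<close> from the centre of \<open>A\<close> to a facet, take a flag of
  that facet for the projection by induction on the dimension, and add \<open>A\<close> to
  it.\<close>

lemma cell_covered_by_flags:
  assumes "A \<in> \<M>" "x \<in> A"
  obtains C where "flag C" "\<And>B. B \<in> C \<Longrightarrow> B \<subseteq> A" "int (card C) = aff_dim A + 1"
    "x \<in> convex hull (b ` C)"
proof -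
  have "\<exists>C. flag C \<and> (\<forall>B\<in>C. B \<subseteq> A) \<and> int (card C) = aff_dim A + 1 \<and> x \<in> convex hull (b ` C)"
    using assms
  proof (induction "nat (aff_dim A)" arbitrary: A x rule: less_induct)
    case less
    have "aff_dim A \<ge> 0"
      using cell_aff_dim_nonneg less.prems(1) .
    show ?case
    proof (cases "aff_dim A = 0")
      case True
      then obtain a where a: "A = {a}"
        using aff_dim_eq_0 by blast
      then have "b A = x"
        using less.prems centre_in by blast
      with less.prems a show ?thesis
        by (intro exI[of _ "{A}"]) (auto simp: subset_chain_def)
    next
      case False
      then have "\<not> (b A = x \<and> A = {b A})"
        by (metis aff_dim_sing)
      then obtain z where z: "z \<in> rel_frontier A" "x \<in> closed_segment (b A) z"
        using segment_to_rel_frontier[OF cell_convex[OF less.prems(1)]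
            polytope_imp_bounded[OF cell_polytope[OF less.prems(1)]] centre[OF less.prems(1)] less.prems(2)]
        by blast
      have "polyhedron A"
        using cell_polytope[OF less.prems(1)] by (rule polytope_imp_polyhedron)
      then obtain F where F: "F face_of A" "F \<noteq> {}" "aff_dim F = aff_dim A - 1" "z \<in> F"
        using z(1) by (auto simp: rel_frontier_of_polyhedron facet_of_def)
      have "F \<in> \<M>"
        using less.prems(1) F(1,2) by (rule face_cell)
      moreover have "nat (aff_dim F) < nat (aff_dim A)"
        using F(3) False \<open>aff_dim A \<ge> 0\<close> by simp
      ultimately obtain C where C: "flag C" "\<forall>B\<in>C. B \<subseteq> F" "int (card C) = aff_dim F + 1"
          "z \<in> convex hull (b ` C)"
        using less.hyps F(4) by blast
      have "F \<subseteq> A" "F \<noteq> A"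
        using F face_of_imp_subset by auto
      then have "A \<notin> C"
        using C(2) by blast
      show ?thesis
      proof (intro exI[of _ "insert A C"] conjI)
        show "flag (insert A C)"
          using C(1,2) \<open>F \<subseteq> A\<close> less.prems(1) unfolding subset_chain_def by blast
        show "\<forall>B\<in>insert A C. B \<subseteq> A"
          using C(2) \<open>F \<subseteq> A\<close> by blast
        show "int (card (insert A C)) = aff_dim A + 1"
          using C(3) F(3) \<open>A \<notin> C\<close> flag_finite[OF C(1)] by simp
        have "z \<in> convex hull (b ` insert A C)"
          using C(4) hull_mono[of "b ` C" "b ` insert A C"] by blast
        moreover have "b A \<in> convex hull (b ` insert A C)"
          by (intro hull_inc) simp
        ultimately show "x \<in> convex hull (b ` insert A C)"
          using z(2) convex_contains_segment convex_convex_hull by blast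
      qed
    qed
  qed
  with that show ?thesis by blast
qed

section \<open>The triangulation by full flags\<close>

definition full_flags :: "'a set set set" where
  "full_flags = {C. flag C \<and> card C = DIM('a) + 1}"

text \<open>Only the top-dimensional simplices are collected, since a mesh lists its tetrahedra and
  not their faces.\<close>

definition subdivision :: "'a set set" where
  "subdivision = (\<lambda>C. convex hull (b ` C)) ` full_flags"

text \<open>The dimensions are distinct, and \<open>{0..DIM('a)}\<close> has just as many elements
  as the flag.\<close>

lemma full_flag_aff_dim_image:
  assumes "C \<in> full_flags"
  shows "aff_dim ` C = {0..DIM('a)}"
proof (rule card_subset_eq)
  have C: "flag C" "card C = DIM('a) + 1"
    using assms by (auto simp: full_flags_def)
  have "C \<subseteq> \<M>"
    using C(1) by (simp add: subset_chain_def)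
  then show "aff_dim ` C \<subseteq> {0..DIM('a)}"
    using cell_aff_dim_nonneg by (intro image_subsetI) (auto simp: aff_dim_le_DIM)
  show "card (aff_dim ` C) = card {0..int DIM('a)}"
    using C flag_inj_on_aff_dim by (simp add: card_image)
qed simp

text \<open>A simplex determines its vertices as its extreme points, and a centre determines its
  cell.\<close>

lemma inj_on_convex_hull_centres: "inj_on (\<lambda>C. convex hull (b ` C)) full_flags"
proof (rule inj_onI)
  fix C D assume CD: "C \<in> full_flags" "D \<in> full_flags" "convex hull (b ` C) = convex hull (b ` D)"
  then have "\<not> affine_dependent (b ` C)" "\<not> affine_dependent (b ` D)" "C \<subseteq> \<M>" "D \<subseteq> \<M>"
    by (auto simp: full_flags_def flag_affine_independent) (auto simp: subset_chain_def)
  with CD(3) have "b ` C = b ` D"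
    using extreme_point_of_convex_hull_affine_independent by (metis subsetI subset_antisym)
  then show "C = D"
    using inj_on_centre \<open>C \<subseteq> \<M>\<close> \<open>D \<subseteq> \<M>\<close> by (simp add: inj_on_image_eq_iff)
qed

lemma simplex_subdivision:
  assumes "K \<in> subdivision"
  shows "int DIM('a) simplex K"
proof -
  obtain C where C: "C \<in> full_flags" "K = convex hull (b ` C)"
    using assms unfolding subdivision_def by blast
  then have fl: "flag C" "card C = DIM('a) + 1"
    by (simp_all add: full_flags_def)
  then have "card (b ` C) = DIM('a) + 1"
    using flag_inj_on_centre by (simp add: card_image)
  then show ?thesis
    using C(2) flag_affine_independent[OF fl(1)] unfolding simplex_def
    by (intro exI[of _ "b ` C"] conjI) auto
qed

text \<open>Two simplices meet in the hull of their common centres, and any subset of affinely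
  independent vertices spans a face.\<close>

lemma triangulation_subdivision: "triangulation subdivision"
  unfolding triangulation_def
proof (intro conjI ballI allI impI)
  have "full_flags \<subseteq> Pow \<M>"
    by (auto simp: full_flags_def subset_chain_def)
  then have "finite full_flags"
    by (rule finite_subset) (simp add: finite_cells)
  then show "finite subdivision"
    by (simp add: subdivision_def)
  show "\<exists>n. n simplex K" if "K \<in> subdivision" for K
    using that simplex_subdivision by blast
  show "K \<inter> L face_of K" if KL: "K \<in> subdivision \<and> L \<in> subdivision" for K L
  proof -
    obtain C D where "flag C" "flag D" and eq: "K = convex hull (b ` C)" "L = convex hull (b ` D)"
      using KL unfolding subdivision_def full_flags_def by blast
    then have "K \<inter> L = convex hull (b ` (C \<inter> D))"
      by (simp add: convex_hull_flag_Int)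
    moreover have "b ` (C \<inter> D) \<subseteq> b ` C"
      by blast
    ultimately show ?thesis
      using flag_affine_independent[OF \<open>flag C\<close>] eq(1) face_of_convex_hull_affine_independent
      by blast
  qed
qed

text \<open>By assumption every point lies in a full-dimensional cell, and a flag covering it there
  has \<open>DIM('a) + 1\<close> members, so it is full.\<close>

lemma Union_subdivision:
  assumes "\<Union>{A \<in> \<M>. aff_dim A = DIM('a)} = \<Union>\<M>"
  shows "\<Union>subdivision = \<Union>\<M>"
proof
  show "\<Union>subdivision \<subseteq> \<Union>\<M>"
    using convex_hull_flag_subset unfolding subdivision_def full_flags_def by blast
  show "\<Union>\<M> \<subseteq> \<Union>subdivision"
  proof
    fix x assume "x \<in> \<Union>\<M>"
    then obtain A where A: "A \<in> \<M>" "aff_dim A = DIM('a)" "x \<in> A"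
      using assms by blast
    obtain C where C: "flag C" "int (card C) = aff_dim A + 1" "x \<in> convex hull (b ` C)"
      using cell_covered_by_flags[OF A(1,3)] .
    then have "C \<in> full_flags"
      using A(2) by (simp add: full_flags_def)
    with C(3) show "x \<in> \<Union>subdivision"
      unfolding subdivision_def by blast
  qed
qed

end

section \<open>Cell complexes from polytopes\<close>

lemma polytope_eq_finite_halfspaces:
  fixes P :: "'a::euclidean_space set"
  assumes "polytope P"
  obtains I :: "('a \<times> real) set"
  where "finite I" "\<And>a b. (a, b) \<in> I \<Longrightarrow> a \<noteq> 0" "P = {x. \<forall>(a, b)\<in>I. a \<bullet> x \<le> b}"
proof -
  obtain F where F: "finite F" "P = \<Inter>F" "\<forall>h\<in>F. \<exists>a b. a \<noteq> 0 \<and> h = {x. a \<bullet> x \<le> b}"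
    using polytope_imp_polyhedron[OF assms] by (auto simp: polyhedron_def)
  have "\<forall>h\<in>F. \<exists>ab. fst ab \<noteq> 0 \<and> h = {x. fst ab \<bullet> x \<le> snd ab}"
    using F(3) by simp
  then obtain g where g: "\<forall>h\<in>F. fst (g h) \<noteq> 0 \<and> h = {x. fst (g h) \<bullet> x \<le> snd (g h)}"
    unfolding bchoice_iff by blast
  show ?thesis
  proof (rule that[of "g ` F"])
    show "finite (g ` F)"
      using F(1) by simp
    show "a \<noteq> 0" if "(a, b) \<in> g ` F" for a b
      using that g by (metis fst_conv imageE)
    show "P = {x. \<forall>(a, b)\<in>g ` F. a \<bullet> x \<le> b}"
    proof -
      have "x \<in> \<Inter>F \<longleftrightarrow> (\<forall>h\<in>F. fst (g h) \<bullet> x \<le> snd (g h))" for x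
        using g by blast
      then show ?thesis
        unfolding F(2) by (auto simp: case_prod_beta)
    qed
  qed
qed

text \<open>After cutting, a full-dimensional cell lies in a polytope as soon as the polytope contains one
  point of the cell that avoids all cutting hyperplanes. Such points are dense in \<open>U\<close>, since the
  hyperplanes and the lower-dimensional cells form a negligible set.\<close>

lemma cell_complex_of_polytopes:
  fixes U :: "'a::euclidean_space set"
  assumes "open U" "finite \<P>" and poly: "\<And>P. P \<in> \<P> \<Longrightarrow> polytope P" and cl: "closure U = \<Union>\<P>"
  obtains \<M> c where "centred_cell_complex \<M> c"
    "\<Union>{A \<in> \<M>. aff_dim A = DIM('a)} = closure U" "\<Union>\<M> = closure U"
proof -
  have "\<forall>P\<in>\<P>. \<exists>I. finite I \<and> (\<forall>(a, b)\<in>I. a \<noteq> 0) \<and> P = {x. \<forall>(a, b)\<in>I. a \<bullet> x \<le> b}"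
  proof
    fix P assume "P \<in> \<P>"
    then obtain I where "finite I" "\<And>a b. (a, b) \<in> I \<Longrightarrow> a \<noteq> 0" "P = {x. \<forall>(a, b)\<in>I. a \<bullet> x \<le> b}"
      using polytope_eq_finite_halfspaces[OF poly] by blast
    then show "\<exists>I. finite I \<and> (\<forall>(a, b)\<in>I. a \<noteq> 0) \<and> P = {x. \<forall>(a, b)\<in>I. a \<bullet> x \<le> b}"
      by (intro exI[of _ I]) auto
  qed
  then obtain I where I': "\<forall>P\<in>\<P>. finite (I P) \<and> (\<forall>(a, b)\<in>I P. a \<noteq> 0) \<and>
      P = {x. \<forall>(a, b)\<in>I P. a \<bullet> x \<le> b}"
    unfolding bchoice_iff by blast
  have I: "\<And>P. P \<in> \<P> \<Longrightarrow> finite (I P)" "\<And>P a b. P \<in> \<P> \<Longrightarrow> (a, b) \<in> I P \<Longrightarrow> a \<noteq> 0"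
    "\<And>P. P \<in> \<P> \<Longrightarrow> P = {x. \<forall>(a, b)\<in>I P. a \<bullet> x \<le> b}"
    using I' by blast+
  define H where "H = (\<Union>P\<in>\<P>. I P)"
  have "finite H"
    using \<open>finite \<P>\<close> I(1) by (simp add: H_def)
  have "bounded (\<Union>\<P>)"
    using \<open>finite \<P>\<close> poly polytope_imp_bounded by blast
  then obtain r where r: "\<Union>\<P> \<subseteq> cbox (- r) r"
    using bounded_subset_cbox_symmetric by blast
  \<comment> \<open>No cell of \<open>\<G>\<close> has points strictly on both sides of a hyperplane
    from \<open>H\<close>.\<close>
  obtain \<G> where G: "\<Union>\<G> = cbox (- r) r" "finite \<G>" "\<forall>X\<in>\<G>. polytope X"
      "\<forall>X\<in>\<G>. \<forall>Y\<in>\<G>. X \<inter> Y face_of X"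
      "\<forall>X\<in>\<G>. \<forall>x\<in>X. \<forall>y\<in>X. \<forall>a b. (a, b) \<in> H \<longrightarrow>
         a \<bullet> x \<le> b \<and> a \<bullet> y \<le> b \<or> a \<bullet> x \<ge> b \<and> a \<bullet> y \<ge> b"
    using cell_subdivision_lemma[of "{cbox (- r) r}" "DIM('a)" H] \<open>finite H\<close>
    by (auto simp: polytope_interval aff_dim_le_DIM face_of_refl_eq)
  \<comment> \<open>Taking only the full-dimensional cells and their faces makes the complex
    pure.\<close>
  define \<C> where "\<C> = {C \<in> \<G>. aff_dim C = DIM('a) \<and> C \<subseteq> closure U}"
  define \<M> where "\<M> = {F. F \<noteq> {} \<and> (\<exists>C\<in>\<C>. F face_of C)}"
  have "closed (\<Union>\<C>)"
    using G(2,3) polytope_imp_closed by (auto simp: \<C>_def intro!: closed_Union)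
  have "U \<subseteq> \<Union>\<C>"
  proof (rule ccontr)
    assume "\<not> U \<subseteq> \<Union>\<C>"
    then have ne: "U - \<Union>\<C> \<noteq> {}" by blast
    have "open (U - \<Union>\<C>)"
      using \<open>open U\<close> \<open>closed (\<Union>\<C>)\<close> by (rule open_Diff)
    define N where "N = \<Union>{C \<in> \<G>. aff_dim C \<noteq> DIM('a)} \<union> (\<Union>(a, b)\<in>H. {x. a \<bullet> x = b})"
    have "negligible C" if "C \<in> \<G>" "aff_dim C \<noteq> DIM('a)" for C
    proof -
      have "convex C"
        using that G(3) polytope_imp_convex by blast
      moreover have "interior C = {}"
        using that aff_dim_nonempty_interior by blast
      ultimately show ?thesis
        by (simp add: negligible_convex_interior)
    qed
    then have "negligible N"
      unfolding N_def using G(2) \<open>finite H\<close> I(2)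
      by (intro negligible_Un negligible_Union) (auto simp: H_def intro!: negligible_hyperplane)
    then have "\<not> U - \<Union>\<C> \<subseteq> N"
      using ne \<open>open (U - \<Union>\<C>)\<close> open_not_negligible negligible_subset by blast
    then obtain x where x: "x \<in> U" "x \<notin> \<Union>\<C>" "x \<notin> N" by blast
    then obtain P where P: "P \<in> \<P>" "x \<in> P"
      using cl closure_subset by blast
    then obtain C where C: "C \<in> \<G>" "x \<in> C"
      using r G(1) by blast
    then have dimC: "aff_dim C = DIM('a)"
      using x(3) by (auto simp: N_def)
    \<comment> \<open>Avoiding the hyperplanes, \<open>x\<close> lies strictly inside all halfspaces
      of \<open>P\<close>; the cell \<open>C\<close> crosses none of their boundaries and stays on
      the side of \<open>x\<close>.\<close>
    have "C \<subseteq> P"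
    proof
      fix y assume "y \<in> C"
      have "a \<bullet> y \<le> b" if ab: "(a, b) \<in> I P" for a b
      proof -
        have "(a, b) \<in> H" using ab P by (auto simp: H_def)
        moreover from this have "a \<bullet> x \<noteq> b" using x(3) by (auto simp: N_def)
        moreover have "a \<bullet> x \<le> b" using P ab I(3) by blast
        ultimately show ?thesis
          using G(5) C \<open>y \<in> C\<close> by fastforce
      qed
      then show "y \<in> P"
        using I(3)[OF P(1)] by blast
    qed
    then have "C \<in> \<C>"
      using C(1) dimC P(1) cl by (auto simp: \<C>_def)
    with C(2) x(2) show False by blast
  qed
  then have cover: "closure U \<subseteq> \<Union>\<C>"
    using \<open>closed (\<Union>\<C>)\<close> by (simp add: closure_minimal)
  have polyC: "polytope C" if "C \<in> \<C>" for C
    using that G(3) unfolding \<C>_def by blast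
  define c where "c A = (SOME x. x \<in> rel_interior A)" for A :: "'a set"
  have "centred_cell_complex \<M> c"
  proof
    have "finite \<C>"
      using G(2) by (auto simp: \<C>_def)
    then have "finite (\<Union>C\<in>\<C>. {F. F face_of C})"
      using polyC finite_polytope_faces by (intro finite_UN_I) auto
    moreover have "\<M> \<subseteq> (\<Union>C\<in>\<C>. {F. F face_of C})"
      by (auto simp: \<M>_def)
    ultimately show "finite \<M>"
      by (rule rev_finite_subset)
    show poly: "polytope A" if "A \<in> \<M>" for A
      using that polyC face_of_polytope_polytope unfolding \<M>_def by blast
    show ne: "A \<noteq> {}" if "A \<in> \<M>" for A
      using that by (simp add: \<M>_def)
    show "F \<in> \<M>" if "A \<in> \<M>" "F face_of A" "F \<noteq> {}" for A F
      using that face_of_trans unfolding \<M>_def by blast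
    show "A \<inter> B face_of A" if AB: "A \<in> \<M>" "B \<in> \<M>" for A B
    proof -
      obtain C D where CD: "C \<in> \<C>" "A face_of C" "D \<in> \<C>" "B face_of D"
        using AB unfolding \<M>_def by blast
      then have "C \<in> \<G>" "D \<in> \<G>"
        by (auto simp: \<C>_def)
      then have "C \<inter> D face_of C" "C \<inter> D face_of D"
        using G(4) by (auto simp: Int_commute)
      then show ?thesis
        using face_of_Int_subface CD by blast
    qed
    show "c A \<in> rel_interior A" if "A \<in> \<M>" for A
    proof -
      have "rel_interior A \<noteq> {}"
        using ne[OF that] polytope_imp_convex[OF poly[OF that]] by (simp add: rel_interior_eq_empty)
      then show ?thesis
        unfolding c_def by (rule some_in_eq[THEN iffD2])
    qed
  qed
  moreover have "\<Union>\<M> \<subseteq> closure U"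
    using face_of_imp_subset by (fastforce simp: \<M>_def \<C>_def)
  moreover have "C \<in> {A \<in> \<M>. aff_dim A = DIM('a)}" if "C \<in> \<C>" for C
    using that polyC polytope_imp_convex face_of_refl by (fastforce simp: \<M>_def \<C>_def)
  then have "closure U \<subseteq> \<Union>{A \<in> \<M>. aff_dim A = DIM('a)}"
    using cover by blast
  ultimately show ?thesis
    by (intro that) blast+
qed

section \<open>The colouring\<close>

locale spatial_cell_complex = centred_cell_complex \<M> b
  for \<M> :: "(real ^ 3) set set" and b
begin

text \<open>Sorts the vertices of a simplex by the dimension of their cells. Outside
  \<open>{0..3}\<close> the value is arbitrary; \<open>orientation\<close> reads only these
  four.\<close>

definition vertex :: "(real ^ 3) set set \<Rightarrow> int \<Rightarrow> real ^ 3" where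
  "vertex C k = b (inv_into C aff_dim k)"

lemma full_flagD:
  assumes "C \<in> full_flags"
  shows "flag C" "card C = 4" "inj_on aff_dim C" "aff_dim ` C = {0..3}"
  using assms flag_inj_on_aff_dim full_flag_aff_dim_image[OF assms] by (simp_all add: full_flags_def)

lemma vertex_aff_dim: "C \<in> full_flags \<Longrightarrow> A \<in> C \<Longrightarrow> vertex C (aff_dim A) = b A"
  by (simp add: vertex_def full_flagD)

lemma vertex_image:
  assumes "C \<in> full_flags" "D \<subseteq> C"
  shows "vertex C ` aff_dim ` D = b ` D"
  unfolding image_image using assms by (intro image_cong) (auto simp: vertex_aff_dim)

lemma vertices_full_flag: "C \<in> full_flags \<Longrightarrow> vertex C ` {0..3} = b ` C"
  using vertex_image[of C C] by (simp add: full_flagD)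

lemma vertices_independent: "C \<in> full_flags \<Longrightarrow> \<not> affine_dependent (vertex C ` {0..3})"
  by (simp add: vertices_full_flag flag_affine_independent full_flagD)

lemma inj_on_vertex:
  assumes "C \<in> full_flags"
  shows "inj_on (vertex C) {0..3}"
proof (rule eq_card_imp_inj_on)
  have "card (b ` C) = 4"
    using flag_inj_on_centre full_flagD[OF assms] by (simp add: card_image)
  then show "card (vertex C ` {0..3}) = card {0..3::int}"
    by (simp add: vertices_full_flag[OF assms])
qed simp

lemma vertex_orientation_nonzero: "C \<in> full_flags \<Longrightarrow> orientation (vertex C) \<noteq> 0"
  by (intro orientation_nonzero inj_on_vertex vertices_independent)

text \<open>Exchanging one cell of a full flag keeps its dimension, so only one slot of the vertex
  order changes. Equal signs would make the simplices overlap outside the hull of their common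
  centres, contradicting \<open>convex_hull_flag_Int\<close>.\<close>

lemma orientation_adjacent:
  assumes C: "C \<in> full_flags" and D: "D \<in> full_flags" and card3: "card (C \<inter> D) = 3"
  shows "orientation (vertex C) * orientation (vertex D) < 0"
proof -
  have fin: "finite C" "finite D"
    using C D flag_finite full_flagD by blast+
  have "card (C - D) = 1" "card (D - C) = 1"
    using card3 fin full_flagD(2)[OF C] full_flagD(2)[OF D]
    by (simp_all add: card_Diff_subset_Int Int_commute)
  then obtain A B where A: "C - D = {A}" and B: "D - C = {B}"
    by (metis card_1_singletonE)
  define E where "E = C \<inter> D"
  define i where "i = aff_dim A"
  have CE: "C = insert A E" "A \<notin> E" and DE: "D = insert B E" "B \<notin> E"
    using A B by (auto simp: E_def)
  have dimE: "aff_dim ` E = {0..3} - {i}"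
    using full_flagD(3,4)[OF C] CE by (auto simp: i_def inj_on_def)
  \<comment> \<open>\<open>E\<close> has cells of all dimensions but one, so the two exchanged cells
    have the same dimension.\<close>
  have "aff_dim ` E = {0..3} - {aff_dim B}"
    using full_flagD(3,4)[OF D] DE by (auto simp: inj_on_def)
  moreover have i: "i \<in> {0..3}" and "aff_dim B \<in> {0..3}"
    using full_flagD(4)[OF C] full_flagD(4)[OF D] CE DE by (auto simp: i_def)
  ultimately have dimB: "aff_dim B = i"
    using dimE by blast
  have EC: "E \<subseteq> C"
    by (simp add: E_def)
  have upd: "vertex D k = ((vertex C)(i := b B)) k" if k: "k \<in> {0..3}" for k
  proof (cases "k = i")
    case True
    then show ?thesis
      using vertex_aff_dim[OF D, of B] DE dimB by simp
  next
    case False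
    then obtain F where "F \<in> E" "k = aff_dim F"
      using k dimE by blast
    then show ?thesis
      using False vertex_aff_dim[OF C, of F] vertex_aff_dim[OF D, of F] CE DE by simp
  qed
  have "\<not> orientation (vertex C) * orientation (vertex D) > 0"
  proof
    assume "orientation (vertex C) * orientation (vertex D) > 0"
    moreover have "orientation (vertex D) = orientation ((vertex C)(i := b B))"
      using upd by (rule orientation_cong)
    ultimately have "orientation (vertex C) * orientation ((vertex C)(i := b B)) > 0"
      by (simp only:)
    then obtain y where y: "y \<in> convex hull (vertex C ` {0..3})"
        "y \<in> convex hull ((vertex C)(i := b B) ` {0..3})" "y \<notin> convex hull (vertex C ` ({0..3} - {i}))"
      using same_orientation_overlap[OF inj_on_vertex[OF C] vertices_independent[OF C] i] by blast
    have "(vertex C)(i := b B) ` {0..3} = vertex D ` {0..3}"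
      using upd by (metis (no_types, lifting) image_cong)
    then have "y \<in> convex hull (b ` C) \<inter> convex hull (b ` D)"
      using y(1,2) by (simp add: vertices_full_flag C D)
    also have "\<dots> = convex hull (b ` E)"
      unfolding E_def using convex_hull_flag_Int full_flagD(1) C D by blast
    also have "b ` E = vertex C ` ({0..3} - {i})"
      using vertex_image[OF C EC] dimE by simp
    finally show False
      using y(3) by blast
  qed
  moreover have "orientation (vertex C) * orientation (vertex D) \<noteq> 0"
    using vertex_orientation_nonzero C D by simp
  ultimately show ?thesis
    by linarith
qed

text \<open>The frontiers lie in the closed simplices, which meet in the hull of the common centres.
  Positive area needs at least three of these, and distinct full flags share at most three
  cells.\<close>

lemma area_flag_Int:
  assumes C: "C \<in> full_flags" and D: "D \<in> full_flags" and "C \<noteq> D"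
    and pos: "area (frontier (convex hull (b ` C)) \<inter> frontier (convex hull (b ` D))) > 0"
  shows "card (C \<inter> D) = 3"
proof -
  have fin: "finite C" "finite D"
    using C D flag_finite full_flagD by blast+
  then have "frontier (convex hull (b ` C)) \<inter> frontier (convex hull (b ` D)) \<subseteq>
      convex hull (b ` C) \<inter> convex hull (b ` D)"
    by (intro Int_mono frontier_subset_closed compact_imp_closed finite_imp_compact_convex_hull) auto
  also have "\<dots> = convex hull (b ` (C \<inter> D))"
    using convex_hull_flag_Int full_flagD(1) C D by blast
  finally have "area (convex hull (b ` (C \<inter> D))) \<noteq> 0"
    using pos area_mono by (metis le_zero_eq less_irrefl)
  then have "\<not> card (b ` (C \<inter> D)) \<le> 2"
    using area_convex_hull_le_2[of "b ` (C \<inter> D)"] fin(1) by auto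
  then have "card (C \<inter> D) \<ge> 3"
    using card_image_le[of "C \<inter> D" b] fin by simp
  moreover have "\<not> C \<subseteq> D"
  proof
    assume "C \<subseteq> D"
    then have "C = D"
      using full_flagD(2) C D by (intro card_subset_eq fin(2)) simp_all
    with \<open>C \<noteq> D\<close> show False by blast
  qed
  then have "card (C \<inter> D) < card C"
    using fin(1) by (intro psubset_card_mono) blast+
  ultimately show ?thesis
    using full_flagD(2)[OF C] by simp
qed

lemma bipartite_subdivision: "bipartite (mesh_graph subdivision)"
proof -
  define hull_of where "hull_of C = convex hull (b ` C)" for C
  define U where "U = hull_of ` {C \<in> full_flags. orientation (vertex C) > 0}"
  define V where "V = hull_of ` {C \<in> full_flags. orientation (vertex C) < 0}"
  have sub: "subdivision = hull_of ` full_flags"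
    by (simp add: subdivision_def hull_of_def)
  have "full_flags = {C \<in> full_flags. orientation (vertex C) > 0} \<union>
      {C \<in> full_flags. orientation (vertex C) < 0}"
    using vertex_orientation_nonzero by (auto simp: linorder_neq_iff)
  then have union: "subdivision = U \<union> V"
    unfolding sub U_def V_def image_Un[symmetric] by (rule arg_cong)
  have "inj_on hull_of full_flags"
    unfolding hull_of_def by (rule inj_on_convex_hull_centres)
  \<comment> \<open>Signs belong to flags; as distinct full flags give distinct simplices, no
    simplex receives both colours.\<close>
  then have disj: "U \<inter> V = {}"
    unfolding U_def V_def by (subst inj_on_image_Int[symmetric]) auto
  have "parcs (mesh_graph subdivision) \<subseteq> U \<times> V \<union> V \<times> U"
  proof
    fix e assume "e \<in> parcs (mesh_graph subdivision)"
    then obtain K L where e: "e = (K, L)" and "K \<in> subdivision" "L \<in> subdivision" "K \<noteq> L"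
        and area: "area (frontier K \<inter> frontier L) > 0"
      by (auto simp: mesh_graph_def)
    then obtain C D where CD: "C \<in> full_flags" "D \<in> full_flags" "K = hull_of C" "L = hull_of D"
      unfolding sub by blast
    have "C \<noteq> D"
      using CD \<open>K \<noteq> L\<close> by blast
    have "card (C \<inter> D) = 3"
      using area_flag_Int[OF CD(1,2) \<open>C \<noteq> D\<close>] area CD(3,4) by (simp add: hull_of_def)
    then have "orientation (vertex C) * orientation (vertex D) < 0"
      using orientation_adjacent CD by blast
    then show "e \<in> U \<times> V \<union> V \<times> U"
      using CD unfolding e U_def V_def by (auto simp: mult_less_0_iff)
  qed
  with union disj show ?thesis
    unfolding bipartite_def by (intro exI[of _ U] exI[of _ V]) (simp add: mesh_graph_def)
qed

end

theorem theorem3p23: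
  fixes \<Omega> :: "(real ^ 3) set"
  assumes "polyhedral_domain \<Omega>"
    and "simply_connected \<Omega>"
  shows "\<exists>\<T>. tetrahedral_mesh \<Omega> \<T> \<and> bipartite (mesh_graph \<T>)"
proof -
  obtain \<P> where P: "open \<Omega>" "finite \<P>" "\<And>P. P \<in> \<P> \<Longrightarrow> polytope P" "closure \<Omega> = \<Union>\<P>"
    using assms(1) unfolding polyhedral_domain_def by blast
  obtain \<M> b where M: "centred_cell_complex \<M> b"
      "\<Union>{A \<in> \<M>. aff_dim A = DIM(real ^ 3)} = closure \<Omega>" "\<Union>\<M> = closure \<Omega>"
    using cell_complex_of_polytopes[OF P] .
  interpret spatial_cell_complex \<M> b
    using M(1) by (simp add: spatial_cell_complex_def)
  have "tetrahedral_mesh \<Omega> subdivision"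
    unfolding tetrahedral_mesh_def
    using triangulation_subdivision simplex_subdivision Union_subdivision M(2,3) by simp
  then show ?thesis
    using bipartite_subdivision by blast
qed

end
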